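(* For a ribbon graph $R$ (orientable or not) let $$Q(R)=\sum_{L:E(R)\to\{\phi,\chi,\psi\}} s^{|L^{-1}(\phi)|}\,t^{|L^{-1}(\chi)|}\,(-t)^{|L^{-1}(\psi)|}\,x^{c(R(L))-1}\in\mathbb C[s,t,x],$$ where $R(L)$ is the ribbon graph obtained from $R$ by half-twisting all the ribbons $e$ with $L(e)=\psi$ and erasing all the ribbons $e$ with $L(e)=\phi$, and $c(R(L))$ is the number of connected components of the boundary of $R(L)$. Then $Q$ satisfies the $4$-term relations for ribbon graphs: for any ribbon graph $R$ and any two distinct ribbons $a,b$ of $R$ with neighboring ends, $$Q(R)-Q(R'_{ab})-Q(\widetilde R_{ab})+Q(\widetilde R'_{ab})=0.$$
   Context: A ribbon graph is a (possibly nonorientable) compact surface with boundary presented as a union of finitely many discs (vertices) and finitely many ribbons (edges), each ribbon being a rectangle glued along two opposite sides (its ends) to disjoint arcs on the boundaries of the vertex discs. $E(R)$ is the set of ribbons. Erasing a ribbon removes it, keeping all vertices; half-twisting a ribbon means cutting it across and regluing with a half-twist. $4$-term relation. Two distinct ribbons $a,b$ have neighboring ends if an end $A$ of $a$ and an end $B_1$ of $b$ lie on the boundary of the same vertex disc and one of the boundary arcs between them contains no other ribbon ends. Let $B_2$ be the other end of $b$. - $R'_{ab}$ is obtained by exchanging the neighboring ends $A$ and $B_1$ along the boundary of the vertex: $A$ is moved along the vertex boundary, past $B_1$, to the position neighboring $B_1$ on its other side (keeping its direction along the vertex boundary). - $\widetilde R_{ab}$ is obtained by sliding the end $A$ along the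 free side of the ribbon $b$ that starts at the endpoint of $B_1$ adjacent to $A$, until $A$ lies on the boundary of the vertex disc to which $B_2$ is attached, in the position neighboring $B_2$ at the endpoint of $B_2$ where this free side ends (a handle slide of $a$ over $b$). - $\widetilde R'_{ab}$ is obtained from $R'_{ab}$ by sliding the end $A$ in the same manner along the other free side of $b$ (equivalently, from $\widetilde R_{ab}$ by exchanging the neighboring ends $A$ and $B_2$). All other ribbons, and the other end of $a$, are unchanged. *)

theory Defs
  imports Complex_Main "HOL-Library.FuncSet" "HOL-Computational_Algebra.Polynomial"
begin

text \<open>
  Ribbon graphs are encoded by signed rotation systems. The boundary of each vertex disc is
  traversed in an arbitrarily chosen direction, and \<open>rot v\<close> lists the ribbon ends met on the way;
  it is a cyclic word, so its starting point is immaterial, and it is empty for a disc without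
  ribbon ends. The two ends of the ribbon \<open>e\<close> are \<open>(e, False)\<close> and \<open>(e, True)\<close>. The flag
  \<open>twist e\<close> is relative to the chosen directions: a ribbon with \<open>\<not> twist e\<close> is glued so that
  its two ends, directed along the boundaries of their discs, are directed oppositely across the
  rectangle (an annulus if \<open>e\<close> is a loop), a ribbon with \<open>twist e\<close> has one more half-twist
  (a Moebius band if \<open>e\<close> is a loop). No orientability or connectedness is implied.
\<close>

type_synonym 'e ribbon_end = "'e \<times> bool"

record ('v, 'e) ribbon_graph =
  verts :: "'v set"
  ribbons :: "'e set"
  rot :: "'v \<Rightarrow> 'e ribbon_end list"
  twist :: "'e \<Rightarrow> bool"

definition ends :: "('v, 'e) ribbon_graph \<Rightarrow> 'e ribbon_end set" where
  "ends R = ribbons R \<times> UNIV"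

definition is_ribbon_graph :: "('v, 'e) ribbon_graph \<Rightarrow> bool" where
  "is_ribbon_graph R \<longleftrightarrow>
     finite (verts R) \<and> finite (ribbons R) \<and>
     (\<forall>v\<in>verts R. distinct (rot R v) \<and> set (rot R v) \<subseteq> ends R) \<and>
     (\<forall>d\<in>ends R. \<exists>!v. v \<in> verts R \<and> d \<in> set (rot R v))"

definition follows :: "('v, 'e) ribbon_graph \<Rightarrow> 'e ribbon_end \<Rightarrow> 'e ribbon_end \<Rightarrow> bool" where
  "follows R d d' \<longleftrightarrow>
     (\<exists>v\<in>verts R. \<exists>i<length (rot R v).
        rot R v ! i = d \<and> rot R v ! (Suc i mod length (rot R v)) = d')"

text \<open>
  A ribbon end is an arc on the boundary of a disc; \<open>(d, Before)\<close> and \<open>(d, After)\<close> are its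
  initial and final endpoints with respect to the direction of traversal of that disc.
\<close>

datatype side = Before | After

fun opp :: "side \<Rightarrow> side" where
  "opp Before = After"
| "opp After = Before"

type_synonym 'e corner = "'e ribbon_end \<times> side"

definition corners :: "('v, 'e) ribbon_graph \<Rightarrow> 'e corner set" where
  "corners R = ends R \<times> UNIV"

text \<open>The other endpoint of the free side of a ribbon that starts at the given corner.\<close>

fun across :: "('v, 'e) ribbon_graph \<Rightarrow> 'e corner \<Rightarrow> 'e corner" where
  "across R ((e, i), s) = ((e, \<not> i), if twist R e then s else opp s)"

text \<open>
  The boundary of the surface consists of the arcs of the vertex boundaries between consecutive
  ends and of the free sides of the ribbons, joined at the corners, together with the whole
  boundary circle of each disc without ribbon ends.
\<close>

definition boundary_arcs :: "('v, 'e) ribbon_graph \<Rightarrow> ('e corner \<times> 'e corner) set" where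
  "boundary_arcs R =
     {((d, After), (d', Before)) | d d'. follows R d d'} \<union>
     {(p, across R p) | p. p \<in> corners R}"

definition boundary_components :: "('v, 'e) ribbon_graph \<Rightarrow> nat" where
  "boundary_components R =
     card (corners R // (boundary_arcs R \<union> (boundary_arcs R)\<inverse>)\<^sup>*) +
     card {v \<in> verts R. rot R v = []}"

definition erase :: "'e set \<Rightarrow> ('v, 'e) ribbon_graph \<Rightarrow> ('v, 'e) ribbon_graph" where
  "erase F R = R\<lparr>ribbons := ribbons R - F,
                 rot := (\<lambda>v. filter (\<lambda>d. fst d \<notin> F) (rot R v))\<rparr>"

definition half_twist :: "'e set \<Rightarrow> ('v, 'e) ribbon_graph \<Rightarrow> ('v, 'e) ribbon_graph" where
  "half_twist F R = R\<lparr>twist := (\<lambda>e. if e \<in> F then \<not> twist R e else twist R e)\<rparr>"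

datatype label = Phi | Chi | Psi

definition state :: "('v, 'e) ribbon_graph \<Rightarrow> ('e \<Rightarrow> label) \<Rightarrow> ('v, 'e) ribbon_graph" where
  "state R L = erase {e \<in> ribbons R. L e = Phi} (half_twist {e \<in> ribbons R. L e = Psi} R)"

text \<open>The ring $\mathbb{C}[s,t,x]$ is rendered as $\mathbb{C}[s][t][x]$.\<close>

type_synonym poly_stx = "complex poly poly poly"

definition var_s :: poly_stx where "var_s = [:[:[:0, 1:]:]:]"
definition var_t :: poly_stx where "var_t = [:[:0, 1:]:]"
definition var_x :: poly_stx where "var_x = [:0, 1:]"

text \<open>
  The exponent of \<open>var_x\<close> is truncated only for the ribbon graph without vertices, as every
  disc contributes to the boundary.
\<close>

definition Q :: "('v, 'e) ribbon_graph \<Rightarrow> poly_stx" where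
  "Q R = (\<Sum>L \<in> ribbons R \<rightarrow>\<^sub>E UNIV.
            var_s ^ card {e \<in> ribbons R. L e = Phi} *
            var_t ^ card {e \<in> ribbons R. L e = Chi} *
            (- var_t) ^ card {e \<in> ribbons R. L e = Psi} *
            var_x ^ (boundary_components (state R L) - 1))"

text \<open>
  \<open>neighboring R A (B, s)\<close>: the arc of the vertex boundary that leaves \<open>B\<close> at its endpoint
  \<open>s\<close> leads directly to \<open>A\<close>. If \<open>A\<close> and \<open>B\<close> are the only ends on their vertex, this holds for
  both values of \<open>s\<close>, and \<open>s\<close> selects the arc along which they are regarded as neighbors.
\<close>

fun neighboring :: "('v, 'e) ribbon_graph \<Rightarrow> 'e ribbon_end \<Rightarrow> 'e corner \<Rightarrow> bool" where
  "neighboring R A (B, Before) \<longleftrightarrow> follows R A B"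
| "neighboring R A (B, After) \<longleftrightarrow> follows R B A"

fun insert_at :: "'e ribbon_end \<Rightarrow> 'e corner \<Rightarrow> 'e ribbon_end list \<Rightarrow> 'e ribbon_end list" where
  "insert_at A (B, s) [] = []"
| "insert_at A (B, s) (d # w) =
     (if d = B then (case s of Before \<Rightarrow> [A, B] | After \<Rightarrow> [B, A]) else [d]) @
     insert_at A (B, s) w"

definition move_end ::
  "'e ribbon_end \<Rightarrow> 'e corner \<Rightarrow> ('v, 'e) ribbon_graph \<Rightarrow> ('v, 'e) ribbon_graph" where
  "move_end A p R = R\<lparr>rot := (\<lambda>v. insert_at A p (filter (\<lambda>d. d \<noteq> A) (rot R v)))\<rparr>"

fun exchange ::
  "'e ribbon_end \<Rightarrow> 'e corner \<Rightarrow> ('v, 'e) ribbon_graph \<Rightarrow> ('v, 'e) ribbon_graph" where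
  "exchange A (B, s) R = move_end A (B, opp s) R"

text \<open>
  The end \<open>A\<close>, neighboring the corner \<open>p\<close>, slides along the free side from \<open>p\<close> to
  \<open>q = across R p\<close> and onto the vertex boundary beyond \<open>q\<close>, keeping its direction along this
  path. If \<open>p\<close> and \<open>q\<close> are endpoints of different kinds, the path runs along both vertex
  boundaries with, or along both against, the chosen directions. If they are of the same kind
  (the ribbon is twisted), \<open>A\<close> becomes reversed relative to the direction of its vertex boundary,
  which toggles the flag of its ribbon.
\<close>

definition slide ::
  "'e ribbon_end \<Rightarrow> 'e corner \<Rightarrow> ('v, 'e) ribbon_graph \<Rightarrow> ('v, 'e) ribbon_graph" where
  "slide A p R =
     (let q = across R p; R' = move_end A q R
      in if snd q = snd p then half_twist {fst A} R' else R')"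

end

theory Submission
  imports Defs
begin

text \<open>
  Up to a half-twist of \<open>a\<close>, the four graphs differ only in the place where the end \<open>A\<close> is attached:
  at one of the two endpoints of one of the two ends of \<open>b\<close>. The key fact is that a slide over a
  ribbon that is present does not change the number of boundary components. The states
  then cancel according to their labels. If \<open>a\<close> is erased, all four states have the same boundary; if
  \<open>b\<close> is erased, the two places at the same end of \<open>b\<close> become equal. If \<open>b\<close> has label \<open>Chi\<close>, slides
  identify the states of \<open>R\<close> with those of $\widetilde R_{ab}$, and those of $R'_{ab}$ with those of
  $\widetilde R'_{ab}$. If \<open>b\<close> has label \<open>Psi\<close>, its extra half-twist interchanges the targets of the
  slides and adds a half-twist to \<open>a\<close>: the states of \<open>R\<close> are identified with those of
  $\widetilde R'_{ab}$, and those of $R'_{ab}$ with those of $\widetilde R_{ab}$, with \<open>Chi\<close> and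
  \<open>Psi\<close> interchanged on \<open>a\<close>, and the weights \<open>t\<close> and \<open>- t\<close> cancel.
\<close>

subsection \<open>Cyclic words\<close>

text \<open>Successor pairs of a cyclic word. The set forgets the starting point, and a one-letter
  word still yields one pair.\<close>

definition cyc_pairs :: "'a list \<Rightarrow> ('a \<times> 'a) set" where
  "cyc_pairs w = set (zip w (rotate1 w))"

lemma follows_cyc_pairs:
  "follows R d d' \<longleftrightarrow> (\<exists>v\<in>verts R. (d, d') \<in> cyc_pairs (rot R v))"
proof -
  have "(d, d') \<in> cyc_pairs w \<longleftrightarrow>
      (\<exists>i<length w. w ! i = d \<and> w ! (Suc i mod length w) = d')" for w
    unfolding cyc_pairs_def set_zip by simp (metis nth_rotate1)
  then show ?thesis
    by (simp add: follows_def)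
qed

lemma cyc_pairs_rotate1: "cyc_pairs (rotate1 w) = cyc_pairs w"
proof -
  have "zip (rotate1 xs) (rotate1 ys) = rotate1 (zip xs ys)"
    if "length xs = length ys" for xs ys :: "'a list"
    using that by (cases xs; cases ys) auto
  then show ?thesis
    by (simp add: cyc_pairs_def)
qed

lemma cyc_pairs_append_commute: "cyc_pairs (u @ v) = cyc_pairs (v @ u)"
proof -
  have "cyc_pairs (rotate n w) = cyc_pairs w" for n and w :: "'a list"
    by (induction n) (simp_all add: cyc_pairs_rotate1)
  from this[of "length u" "u @ v"] show ?thesis
    by (simp add: rotate_append)
qed

lemma cyc_pairs_subset: "(x, y) \<in> cyc_pairs w \<Longrightarrow> x \<in> set w \<and> y \<in> set w"
  by (auto simp: cyc_pairs_def dest: set_zip_leftD set_zip_rightD)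

section \<open>Inserting a letter next to another one in a cyclic word\<close>

lemma insert_at_notin: "B \<notin> set w \<Longrightarrow> insert_at A (B, s) w = w"
  by (induction w) auto

lemma insert_at_append: "insert_at A p (u @ v) = insert_at A p u @ insert_at A p v"
  by (cases p) (induction u, auto)

lemma insert_at_eq_Nil [simp]: "insert_at A p w = [] \<longleftrightarrow> w = []"
  by (cases p; cases w) (auto split: side.splits)

lemma filter_insert_at:
  assumes "P A" "P B"
  shows "filter P (insert_at A (B, s) w) = insert_at A (B, s) (filter P w)"
  using assms by (induction w) (auto split: side.splits)

lemma filter_insert_at_absent:
  assumes "\<not> P A"
  shows "filter P (insert_at A (B, s) w) = filter P w"
  using assms by (induction w) (auto split: side.splits)

lemma filter_insert_at_side:
  assumes "\<not> P B"
  shows "filter P (insert_at A (B, s) w) = filter P (insert_at A (B, s') w)"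
  using assms by (induction w) (auto split: side.splits)

text \<open>After a rotation \<open>B\<close> is the first letter, and the insertion affects only
  the pair that leaves \<open>B\<close>.\<close>

lemma cyc_pairs_insert_After:
  assumes "distinct w" "B \<in> set w"
  shows "cyc_pairs (insert_at A (B, After) w) =
    {(x, y) \<in> cyc_pairs w. x \<noteq> B} \<union> {(B, A)} \<union> {(A, y) | y. (B, y) \<in> cyc_pairs w}"
proof -
  obtain u v where w: "w = u @ B # v"
    using assms(2) by (meson split_list)
  with assms(1) have B: "B \<notin> set u" "B \<notin> set v"
    by auto
  define z where "z = v @ u"
  \<comment> \<open>\<open>D\<close> is the cyclic successor of \<open>B\<close>; it is
    \<open>B\<close> itself if \<open>B\<close> is the only letter.\<close>
  obtain D r where Dr: "z @ [B] = D # r"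
    by (cases "z @ [B]") auto
  have "cyc_pairs w = cyc_pairs (B # z)"
    unfolding w z_def using cyc_pairs_append_commute[of u "B # v"] by simp
  then have w_pairs: "cyc_pairs w = insert (B, D) (set (zip z r))"
    by (simp add: cyc_pairs_def Dr)
  have "cyc_pairs (insert_at A (B, After) w) = cyc_pairs (B # A # z)"
    unfolding w z_def using cyc_pairs_append_commute[of u "B # A # v"] B
    by (simp add: insert_at_append insert_at_notin)
  then have ins: "cyc_pairs (insert_at A (B, After) w) = {(B, A), (A, D)} \<union> set (zip z r)"
    by (simp add: cyc_pairs_def Dr)
  have "(B, y) \<notin> set (zip z r)" for y
    using B by (auto simp: z_def dest: set_zip_leftD)
  then show ?thesis
    unfolding w_pairs ins by auto
qed

text \<open>The mirror image of the previous argument: only the pair that enters \<open>B\<close> is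
  affected, and \<open>D\<close> is now the cyclic predecessor of \<open>B\<close>.\<close>

lemma cyc_pairs_insert_Before:
  assumes "distinct w" "B \<in> set w"
  shows "cyc_pairs (insert_at A (B, Before) w) =
    {(x, y) \<in> cyc_pairs w. y \<noteq> B} \<union> {(A, B)} \<union> {(x, A) | x. (x, B) \<in> cyc_pairs w}"
proof -
  obtain u v where w: "w = u @ B # v"
    using assms(2) by (meson split_list)
  with assms(1) have B: "B \<notin> set u" "B \<notin> set v"
    by auto
  define z where "z = v @ u"
  obtain D r where Dr: "B # z = r @ [D]"
    by (metis list.distinct(1) rev_exhaust)
  then have len: "length r = length z"
    by (metis length_Cons length_append_singleton nat.inject)
  have "cyc_pairs w = cyc_pairs (B # z)"
    unfolding w z_def using cyc_pairs_append_commute[of u "B # v"] by simp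
  also have "\<dots> = set (zip (B # z) (z @ [B]))"
    by (simp add: cyc_pairs_def)
  finally have w_pairs: "cyc_pairs w = insert (D, B) (set (zip r z))"
    using len by (simp add: Dr)
  have "cyc_pairs (insert_at A (B, Before) w) = cyc_pairs (A # B # z)"
    unfolding w z_def using cyc_pairs_append_commute[of u "A # B # v"] B
    by (simp add: insert_at_append insert_at_notin)
  also have "\<dots> = insert (A, B) (set (zip (B # z) (z @ [A])))"
    by (simp add: cyc_pairs_def)
  finally have ins: "cyc_pairs (insert_at A (B, Before) w) = {(A, B), (D, A)} \<union> set (zip r z)"
    using len by (simp add: Dr)
  have "(x, B) \<notin> set (zip r z)" for x
    using B by (auto simp: z_def dest: set_zip_rightD)
  then show ?thesis
    unfolding w_pairs ins by auto
qed

subsection \<open>Handle slides preserve the boundary\<close>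

text \<open>Maps that preserve connectedness and are mutually inverse up to paths induce a bijection
  of classes, as homotopy equivalences do on components. Thus \<open>f\<close> and \<open>g\<close>
  may merge points.\<close>

lemma card_quotient_eqI:
  assumes "sym E" "sym F"
    and fC: "\<And>x. x \<in> C \<Longrightarrow> f x \<in> D" and gD: "\<And>y. y \<in> D \<Longrightarrow> g y \<in> C"
    and fE: "\<And>x y. (x, y) \<in> E \<Longrightarrow> (f x, f y) \<in> F\<^sup>*"
    and gF: "\<And>x y. (x, y) \<in> F \<Longrightarrow> (g x, g y) \<in> E\<^sup>*"
    and gf: "\<And>x. x \<in> C \<Longrightarrow> (g (f x), x) \<in> E\<^sup>*"
    and fg: "\<And>y. y \<in> D \<Longrightarrow> (f (g y), y) \<in> F\<^sup>*"
  shows "card (C // E\<^sup>*) = card (D // F\<^sup>*)"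
proof -
  have symE: "sym (E\<^sup>*)" and symF: "sym (F\<^sup>*)"
    using assms(1,2) by (auto intro: sym_rtrancl)
  have eE: "equiv UNIV (E\<^sup>*)" and eF: "equiv UNIV (F\<^sup>*)"
    using symE symF by (auto intro!: equivI simp: refl_rtrancl trans_rtrancl)
  have f: "(f x, f y) \<in> F\<^sup>*" if "(x, y) \<in> E\<^sup>*" for x y
    using that by induction (auto intro: fE rtrancl_trans)
  have g: "(g x, g y) \<in> E\<^sup>*" if "(x, y) \<in> F\<^sup>*" for x y
    using that by induction (auto intro: gF rtrancl_trans)
  \<comment> \<open>The image of a class under \<open>f\<close> need not be a whole class, so it is
    closed under \<open>F\<^sup>*\<close>.\<close>
  define h where "h X = F\<^sup>* `` (f ` X)" for X
  have h: "h (E\<^sup>* `` {x}) = F\<^sup>* `` {f x}" for x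
    unfolding h_def using f by (auto intro: rtrancl_trans)
  have inj: "E\<^sup>* `` {x} = E\<^sup>* `` {y}"
    if "x \<in> C" "y \<in> C" "F\<^sup>* `` {f x} = F\<^sup>* `` {f y}" for x y
  proof -
    have "(f x, f y) \<in> F\<^sup>*"
      using that(3) eF by (simp add: eq_equiv_class_iff)
    then have "(g (f x), g (f y)) \<in> E\<^sup>*"
      by (rule g)
    then have "(x, y) \<in> E\<^sup>*"
      using gf[OF that(1)] gf[OF that(2)] symE by (meson rtrancl_trans symD)
    then show ?thesis
      using eE by (simp add: equiv_class_eq)
  qed
  have "bij_betw h (C // E\<^sup>*) (D // F\<^sup>*)"
  proof (rule bij_betw_imageI)
    show "inj_on h (C // E\<^sup>*)"
      by (auto simp: inj_on_def quotient_def h dest: inj)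
    show "h ` (C // E\<^sup>*) = D // F\<^sup>*"
    proof
      show "h ` (C // E\<^sup>*) \<subseteq> D // F\<^sup>*"
        using fC by (auto simp: h elim!: quotientE intro!: quotientI)
      have "F\<^sup>* `` {y} \<in> h ` (C // E\<^sup>*)" if "y \<in> D" for y
      proof -
        have "F\<^sup>* `` {y} = h (E\<^sup>* `` {g y})"
          using fg[OF that] eF by (simp add: h equiv_class_eq)
        moreover have "E\<^sup>* `` {g y} \<in> C // E\<^sup>*"
          using gD[OF that] by (rule quotientI)
        ultimately show ?thesis by blast
      qed
      then show "D // F\<^sup>* \<subseteq> h ` (C // E\<^sup>*)"
        by (auto elim!: quotientE)
    qed
  qed
  then show ?thesis
    by (rule bij_betw_same_card)
qed

lemma opp_opp [simp]: "opp (opp s) = s"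
  by (cases s) auto

lemma opp_neq [simp]: "opp s \<noteq> s" "s \<noteq> opp s"
  by (cases s; simp)+

lemma neq_iff_opp: "s \<noteq> s' \<longleftrightarrow> s' = opp s"
  by (cases s; cases s') auto

section \<open>The boundary as a union of vertex arcs and free sides\<close>

definition vertex_arcs :: "('v, 'e) ribbon_graph \<Rightarrow> ('e corner \<times> 'e corner) set" where
  "vertex_arcs R = {((d, After), (d', Before)) | d d'. follows R d d'} \<union>
     {((d', Before), (d, After)) | d d'. follows R d d'}"

definition free_sides :: "('v, 'e) ribbon_graph \<Rightarrow> ('e corner \<times> 'e corner) set" where
  "free_sides R = {(p, across R p) | p. p \<in> corners R}"

lemma free_sides_iff: "(p, q) \<in> free_sides R \<longleftrightarrow> p \<in> corners R \<and> q = across R p"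
  unfolding free_sides_def by blast

lemma across_across [simp]: "across R (across R p) = p"
  by (cases "(R, p)" rule: across.cases) auto

lemma across_in_corners: "p \<in> corners R \<Longrightarrow> across R p \<in> corners R"
  by (cases "(R, p)" rule: across.cases) (auto simp: corners_def ends_def)

lemma sym_vertex_arcs: "sym (vertex_arcs R)"
  by (auto simp: sym_def vertex_arcs_def)

lemma sym_free_sides: "sym (free_sides R)"
  by (rule symI) (metis across_across across_in_corners free_sides_iff)

lemma boundary_arcs_sym:
  "boundary_arcs R \<union> (boundary_arcs R)\<inverse> = vertex_arcs R \<union> free_sides R"
proof -
  have "(free_sides R)\<inverse> = free_sides R"
    using sym_free_sides by (simp add: sym_conv_converse_eq)
  then show ?thesis
    unfolding boundary_arcs_def vertex_arcs_def free_sides_def[symmetric] by auto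
qed

text \<open>The common base of all graphs that differ only in the place of \<open>A\<close>: the
  ribbon of \<open>A\<close> stays in \<open>ribbons\<close>, while this end lies on no
  disc.\<close>

definition detach :: "'e ribbon_end \<Rightarrow> ('v, 'e) ribbon_graph \<Rightarrow> ('v, 'e) ribbon_graph" where
  "detach A R = R\<lparr>rot := \<lambda>v. filter (\<lambda>d. d \<noteq> A) (rot R v)\<rparr>"

text \<open>Splices \<open>A\<close> into the arc at \<open>p\<close>. Arcs join
  \<open>After\<close> to \<open>Before\<close>, so the endpoint of \<open>A\<close> facing
  \<open>p\<close> has the kind opposite to that of \<open>p\<close>; the other endpoint takes over
  the former neighbor of \<open>p\<close>.\<close>

definition insert_arcs ::
  "'e ribbon_end \<Rightarrow> 'e corner \<Rightarrow> ('e corner \<times> 'e corner) set \<Rightarrow> ('e corner \<times> 'e corner) set" where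
  "insert_arcs A p N =
     {(x, y) \<in> N. x \<noteq> p \<and> y \<noteq> p} \<union>
     {(p, (A, opp (snd p))), ((A, opp (snd p)), p)} \<union>
     {(r, (A, snd p)) | r. (r, p) \<in> N} \<union> {((A, snd p), r) | r. (p, r) \<in> N}"

lemma vertex_arcs_iff:
  "((d, r), (d', r')) \<in> vertex_arcs R \<longleftrightarrow>
    r = After \<and> r' = Before \<and> follows R d d' \<or> r = Before \<and> r' = After \<and> follows R d' d"
  unfolding vertex_arcs_def by blast

lemma insert_arcs_iff:
  "(x, y) \<in> insert_arcs A p N \<longleftrightarrow>
    (x, y) \<in> N \<and> x \<noteq> p \<and> y \<noteq> p \<or> x = p \<and> y = (A, opp (snd p)) \<or>
    x = (A, opp (snd p)) \<and> y = p \<or> (x, p) \<in> N \<and> y = (A, snd p) \<or>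
    (p, y) \<in> N \<and> x = (A, snd p)"
  unfolding insert_arcs_def by blast

text \<open>The end \<open>B\<close> lies on exactly one disc, so the insertion alters only the word
  of that disc, where the lemmas on cyclic words apply.\<close>

lemma follows_move_end:
  assumes R: "is_ribbon_graph R" and B: "fst B \<in> ribbons R" "A \<noteq> B"
  shows "follows (move_end A (B, After) R) x y \<longleftrightarrow>
      follows (detach A R) x y \<and> x \<noteq> B \<or> x = B \<and> y = A \<or> x = A \<and> follows (detach A R) B y"
    and "follows (move_end A (B, Before) R) x y \<longleftrightarrow>
      follows (detach A R) x y \<and> y \<noteq> B \<or> x = A \<and> y = B \<or> y = A \<and> follows (detach A R) x B"
proof -
  let ?w = "\<lambda>v. filter (\<lambda>d. d \<noteq> A) (rot R v)"
  have "B \<in> ends R"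
    using B by (cases B) (auto simp: ends_def)
  then obtain v where v: "v \<in> verts R" "B \<in> set (?w v)"
    and unique: "\<And>u. u \<in> verts R \<Longrightarrow> u \<noteq> v \<Longrightarrow> B \<notin> set (?w u)"
    using R B(2) unfolding is_ribbon_graph_def by fastforce
  have dist: "distinct (?w v)"
    using R v(1) by (simp add: is_ribbon_graph_def)
  have other: "insert_at A (B, s) (?w u) = ?w u"
    "(x, B) \<notin> cyc_pairs (?w u)" "(B, x) \<notin> cyc_pairs (?w u)"
    if "u \<in> verts R" "u \<noteq> v" for u x s
    using unique[OF that] by (auto dest: cyc_pairs_subset simp: insert_at_notin)
  have split: "(\<exists>u\<in>verts R. P u) \<longleftrightarrow> P v \<or> (\<exists>u\<in>verts R. u \<noteq> v \<and> P u)" for P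
    using v(1) by metis
  have fol: "follows (detach A R) x y \<longleftrightarrow> (x, y) \<in> cyc_pairs (?w v) \<or>
      (\<exists>u\<in>verts R. u \<noteq> v \<and> (x, y) \<in> cyc_pairs (?w u))" for x y
    unfolding follows_cyc_pairs detach_def by simp (rule split)
  have mov: "follows (move_end A (B, s) R) x y \<longleftrightarrow>
      (x, y) \<in> cyc_pairs (insert_at A (B, s) (?w v)) \<or>
      (\<exists>u\<in>verts R. u \<noteq> v \<and> (x, y) \<in> cyc_pairs (?w u))" for s x y
    unfolding follows_cyc_pairs move_end_def by simp (subst split, auto simp: other)
  show "follows (move_end A (B, After) R) x y \<longleftrightarrow>
      follows (detach A R) x y \<and> x \<noteq> B \<or> x = B \<and> y = A \<or> x = A \<and> follows (detach A R) B y"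
  proof -
    have "(x, y) \<in> cyc_pairs (insert_at A (B, After) (?w v)) \<longleftrightarrow>
        (x, y) \<in> cyc_pairs (?w v) \<and> x \<noteq> B \<or> x = B \<and> y = A \<or> x = A \<and> (B, y) \<in> cyc_pairs (?w v)"
      unfolding cyc_pairs_insert_After[OF dist v(2)] by (auto simp del: split_paired_Ex)
    then show ?thesis
      unfolding fol mov using other(2,3) by blast
  qed
  show "follows (move_end A (B, Before) R) x y \<longleftrightarrow>
      follows (detach A R) x y \<and> y \<noteq> B \<or> x = A \<and> y = B \<or> y = A \<and> follows (detach A R) x B"
  proof -
    have "(x, y) \<in> cyc_pairs (insert_at A (B, Before) (?w v)) \<longleftrightarrow>
        (x, y) \<in> cyc_pairs (?w v) \<and> y \<noteq> B \<or> x = A \<and> y = B \<or> y = A \<and> (x, B) \<in> cyc_pairs (?w v)"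
      unfolding cyc_pairs_insert_Before[OF dist v(2)] by (auto simp del: split_paired_Ex)
    then show ?thesis
      unfolding fol mov using other(2,3) by blast
  qed
qed

lemma vertex_arcs_move_end:
  assumes "is_ribbon_graph R" "fst B \<in> ribbons R" "A \<noteq> B"
  shows "vertex_arcs (move_end A (B, s) R) = insert_arcs A (B, s) (vertex_arcs (detach A R))"
proof -
  have "((d, r), (d', r')) \<in> vertex_arcs (move_end A (B, s) R) \<longleftrightarrow>
      ((d, r), (d', r')) \<in> insert_arcs A (B, s) (vertex_arcs (detach A R))" for d r d' r'
    by (cases s; cases r; cases r')
      (auto simp: vertex_arcs_iff insert_arcs_iff follows_move_end[OF assms])
  then show ?thesis
    by (metis (no_types) surj_pair subrelI subset_antisym)
qed

lemma vertex_arcs_detach: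
  assumes "(x, y) \<in> vertex_arcs (detach A R)"
  shows "x \<noteq> y" "fst x \<noteq> A" "fst y \<noteq> A"
  using assms
  by (auto simp: vertex_arcs_def follows_cyc_pairs detach_def dest!: cyc_pairs_subset)

lemma insert_arcsI:
  "(x, y) \<in> N \<Longrightarrow> x \<noteq> p \<Longrightarrow> y \<noteq> p \<Longrightarrow> (x, y) \<in> insert_arcs A p N"
  "(p, (A, opp (snd p))) \<in> insert_arcs A p N"
  "((A, opp (snd p)), p) \<in> insert_arcs A p N"
  "(r, p) \<in> N \<Longrightarrow> (r, (A, snd p)) \<in> insert_arcs A p N"
  "(p, r) \<in> N \<Longrightarrow> ((A, snd p), r) \<in> insert_arcs A p N"
  unfolding insert_arcs_def by blast+

text \<open>
  On the boundary curves, attaching \<open>A\<close> at \<open>p\<close> or at \<open>q\<close> makes a difference only for the free side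
  from \<open>p\<close> to \<open>q\<close>: it continues at the one or at the other endpoint of \<open>A\<close>, into which it is contracted
  here. If \<open>p\<close> and \<open>q\<close> are of the same kind, \<open>A\<close> is reversed, so its endpoints are swapped.
\<close>

definition slide_map :: "'e ribbon_end \<Rightarrow> 'e corner \<Rightarrow> 'e corner \<Rightarrow> 'e corner \<Rightarrow> 'e corner" where
  "slide_map A p q x =
     (if x = p \<or> x = q then (A, snd q)
      else if fst x = A then (A, if snd x = snd p then opp (snd q) else snd q)
      else x)"

text \<open>\<open>N\<close> models the vertex arcs without \<open>A\<close>, and \<open>M\<close>,
  \<open>M'\<close> the free sides with \<open>A\<close> at \<open>p\<close> and at
  \<open>q\<close>. The arc between \<open>p\<close> and \<open>A\<close> collapses; the arc on the
  far side of \<open>A\<close> becomes a path through \<open>q\<close> and \<open>p\<close>. With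
  \<open>p\<close> and \<open>q\<close> arbitrary, the reverse slide is covered too.\<close>

lemma slide_map_arcs:
  assumes N: "sym N" "\<And>x y. (x, y) \<in> N \<Longrightarrow> x \<noteq> y \<and> fst x \<noteq> A \<and> fst y \<noteq> A"
    and M: "(p, q) \<in> M'" "(q, p) \<in> M'"
      "\<And>x y. (x, y) \<in> M \<Longrightarrow> {x, y} = {p, q} \<or>
         {x, y} \<inter> {p, q} = {} \<and> (slide_map A p q x, slide_map A p q y) \<in> M'"
    and pq: "p \<noteq> q" "fst p \<noteq> A" "fst q \<noteq> A"
    and xy: "(x, y) \<in> insert_arcs A p N \<union> M"
  shows "(slide_map A p q x, slide_map A p q y) \<in> (insert_arcs A q N \<union> M')\<^sup>*"
proof -
  let ?f = "slide_map A p q" and ?E = "insert_arcs A q N \<union> M'"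
  have E: "e \<in> ?E\<^sup>*" if "e \<in> insert_arcs A q N" for e
    using that by (cases e) auto
  have E': "(p, q) \<in> ?E\<^sup>*" "(q, p) \<in> ?E\<^sup>*"
    using M by auto
  have A_neq: "(A, r) \<noteq> p" "(A, r) \<noteq> q" for r
    using pq(2,3) by auto
  have f: "?f p = (A, snd q)" "?f q = (A, snd q)" "?f (A, opp (snd p)) = (A, snd q)"
    "?f (A, snd p) = (A, opp (snd q))"
    using pq(1) A_neq by (simp_all add: slide_map_def)
  have f_id: "?f z = z" if "fst z \<noteq> A" "z \<noteq> p" "z \<noteq> q" for z
    using that by (simp add: slide_map_def)
  \<comment> \<open>In the target, the endpoint of \<open>A\<close> facing \<open>q\<close> reaches
    \<open>p\<close> through \<open>q\<close> and the free side.\<close>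
  have A_p: "((A, opp (snd q)), p) \<in> ?E\<^sup>*" "(p, (A, opp (snd q))) \<in> ?E\<^sup>*"
  proof -
    have "((A, opp (snd q)), q) \<in> ?E\<^sup>*" "(q, (A, opp (snd q))) \<in> ?E\<^sup>*"
      by (rule E, rule insert_arcsI)+
    then show "((A, opp (snd q)), p) \<in> ?E\<^sup>*" "(p, (A, opp (snd q))) \<in> ?E\<^sup>*"
      using E' by (meson rtrancl_trans)+
  qed
  have side: "((A, opp (snd q)), ?f r) \<in> ?E\<^sup>* \<and> (?f r, (A, opp (snd q))) \<in> ?E\<^sup>*"
    if r: "(p, r) \<in> N" for r
  proof -
    have rp: "(r, p) \<in> N" "r \<noteq> p" "fst r \<noteq> A"
      using symD[OF N(1) r] N(2)[OF r] by auto
    have *: "(p, ?f r) \<in> ?E\<^sup>* \<and> (?f r, p) \<in> ?E\<^sup>*"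
    \<comment> \<open>If the vertex arc at \<open>p\<close> leads to \<open>q\<close> itself, then
      \<open>A\<close> placed at \<open>q\<close> splits this arc.\<close>
    proof (cases "r = q")
      case True
      then show ?thesis
        using r rp(1) by (simp add: f E insert_arcsI)
    next
      case False
      then show ?thesis
        using r rp pq(1) by (simp add: f_id E insert_arcsI)
    qed
    then show ?thesis
      using A_p by (meson rtrancl_trans)
  qed
  consider (N) "(x, y) \<in> N" "x \<noteq> p" "y \<noteq> p"
    | (p) "{x, y} = {p, (A, opp (snd p))}"
    | (r) "(x, p) \<in> N" "y = (A, snd p)"
    | (r') "(p, y) \<in> N" "x = (A, snd p)"
    | (M) "(x, y) \<in> M"
    using xy unfolding insert_arcs_def by auto
  then show ?thesis
  proof cases
    case N
    have props: "x \<noteq> y" "y \<noteq> x" "fst x \<noteq> A" "fst y \<noteq> A"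
      using assms(2)[OF N(1)] by auto
    show ?thesis
    proof (cases "x = q \<or> y = q")
      case True
      then show ?thesis
        using N props by (elim disjE) (simp_all add: f f_id E insert_arcsI)
    next
      case False
      then show ?thesis
        using N props by (simp add: f_id E insert_arcsI)
    qed
  next
    case p
    then have "?f x = ?f y"
      using f by (auto simp: doubleton_eq_iff)
    then show ?thesis by simp
  next
    case r
    then show ?thesis
      using side[of x] N(1) by (auto simp: f dest: symD)
  next
    case r'
    then show ?thesis
      using side[of y] by (simp add: f)
  next
    case M
    from assms(5)[OF this] show ?thesis
      using f by (auto simp: doubleton_eq_iff)
  qed
qed

text \<open>The round trip moves only \<open>p\<close> and \<open>q\<close>, to an endpoint of
  \<open>A\<close> that is joined to them when \<open>A\<close> is attached at \<open>p\<close>;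
  hence it is the identity up to paths.\<close>

lemma slide_map_slide_map:
  assumes "fst p \<noteq> A" "fst q \<noteq> A"
  shows "slide_map A q p (slide_map A p q x) = (if x = p \<or> x = q then (A, opp (snd p)) else x)"
proof -
  have "(A, r) \<noteq> p" "(A, r) \<noteq> q" for r
    using assms by auto
  then show ?thesis
    using assms by (cases x) (auto simp: slide_map_def neq_iff_opp)
qed

text \<open>The two graphs have \<open>A\<close> at the two endpoints of one free side of the ribbon
  of \<open>B\<close>. The slide maps in both directions contract this free side and are inverse up
  to paths.\<close>

lemma boundary_components_slide:
  assumes R: "is_ribbon_graph R" and A: "fst A \<in> ribbons R"
    and B: "fst B \<in> ribbons R" and AB: "fst A \<noteq> fst B"
  shows "boundary_components (slide A (B, s) R) = boundary_components (move_end A (B, s) R)"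
proof -
  define p where "p = (B, s)"
  define q where "q = across R p"
  obtain e i where B_eq: "B = (e, i)" by (cases B)
  obtain a j where A_eq: "A = (a, j)" by (cases A)
  have q_eq: "q = ((e, \<not> i), if twist R e then s else opp s)"
    by (simp add: q_def p_def B_eq)
  have ne: "p \<noteq> q" "fst p \<noteq> A" "fst q \<noteq> A" "e \<noteq> a"
    using AB by (auto simp: p_def q_eq B_eq A_eq)
  define X Y where XY: "X = move_end A p R" "Y = slide A p R"
  let ?N = "vertex_arcs (detach A R)"
  let ?f = "slide_map A p q" and ?g = "slide_map A q p"
  let ?E = "insert_arcs A p ?N \<union> free_sides X" and ?F = "insert_arcs A q ?N \<union> free_sides Y"
  have fields: "verts X = verts R" "ribbons X = ribbons R" "twist X = twist R"
    "verts Y = verts R" "ribbons Y = ribbons R" "rot Y = rot (move_end A q R)"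
    "twist Y = (\<lambda>c. if c = a \<and> snd p = snd q then \<not> twist R c else twist R c)"
    by (auto simp: XY slide_def move_end_def half_twist_def q_def[symmetric] A_eq Let_def)
  have corners: "corners X = corners R" "corners Y = corners R"
    by (simp_all add: corners_def ends_def fields)
  have "follows Y = follows (move_end A q R)"
    by (simp add: follows_def fields fun_eq_iff move_end_def)
  then have arcs_Y: "vertex_arcs Y = insert_arcs A q ?N"
    using vertex_arcs_move_end[OF R, of "fst q" A "snd q"] ne B
    by (auto simp: vertex_arcs_def q_eq B_eq)
  have arcs_X: "vertex_arcs X = insert_arcs A p ?N"
    using vertex_arcs_move_end[OF R B, of A s] AB by (auto simp: XY p_def)
  have "twist X e = twist R e" "twist Y e = twist R e"
    using ne(4) by (simp_all add: fields)
  then have across_X: "across X p = q" "across X q = p"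
    and across_Y: "across Y p = q" "across Y q = p"
    by (auto simp: p_def q_eq B_eq)
  \<comment> \<open>Away from \<open>p\<close> and \<open>q\<close> the maps commute with crossing a
    ribbon: on the ribbon \<open>a\<close>, the toggled flag compensates for the swapped endpoints
    of \<open>A\<close>.\<close>
  have fg_across: "?f (across X x) = across Y (?f x)" "?g (across Y x) = across X (?g x)"
    if "x \<noteq> p" "x \<noteq> q" for x
  proof -
    have ne_X: "across X x \<noteq> p" "across X x \<noteq> q" and ne_Y: "across Y x \<noteq> p" "across Y x \<noteq> q"
      using that across_X across_Y across_across by metis+
    have maps: "slide_map A r r' z =
        (if fst z = A then (A, if snd z = snd r then opp (snd r') else snd r') else z)"
      if "z \<noteq> r" "z \<noteq> r'" for r r' z
      using that by (simp add: slide_map_def)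
    obtain c k t where x: "x = ((c, k), t)"
      by (metis surj_pair)
    show "?f (across X x) = across Y (?f x)"
      unfolding maps[OF ne_X] maps[OF that]
      by (cases "snd p"; cases "snd q"; cases t; simp add: x A_eq fields)
    show "?g (across Y x) = across X (?g x)"
      unfolding maps[OF ne_Y(2,1)] maps[OF that(2,1)]
      by (cases "snd p"; cases "snd q"; cases t; simp add: x A_eq fields)
  qed
  have map_corners: "?f x \<in> corners R" "?g x \<in> corners R" if "x \<in> corners R" for x
    using that A by (auto simp: slide_map_def corners_def ends_def A_eq)
  have pq_corners: "p \<in> corners R" "q \<in> corners R"
    using B by (auto simp: p_def q_eq B_eq corners_def ends_def)
  have N: "(x, y) \<in> ?N \<Longrightarrow> x \<noteq> y \<and> fst x \<noteq> A \<and> fst y \<noteq> A" for x y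
    by (auto dest: vertex_arcs_detach)
  have pq_X: "(p, q) \<in> free_sides X" "(q, p) \<in> free_sides X"
    and pq_Y: "(p, q) \<in> free_sides Y" "(q, p) \<in> free_sides Y"
    using pq_corners by (simp_all only: free_sides_iff corners across_X across_Y)
  have fX: "{x, y} = {p, q} \<or> {x, y} \<inter> {p, q} = {} \<and> (?f x, ?f y) \<in> free_sides Y"
    if "(x, y) \<in> free_sides X" for x y
  proof -
    have y: "y = across X x" "x \<in> corners R" using that by (simp_all only: free_sides_iff corners)
    show ?thesis
    proof (cases "x = p \<or> x = q")
      case True then show ?thesis using y across_X by auto
    next
      case False
      then have "y \<noteq> p" "y \<noteq> q" using y across_X across_across by metis+
      then show ?thesis
        using False y fg_across(1)[of x] map_corners by (simp only: free_sides_iff corners) blast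
    qed
  qed
  have gY: "{x, y} = {q, p} \<or> {x, y} \<inter> {q, p} = {} \<and> (?g x, ?g y) \<in> free_sides X"
    if "(x, y) \<in> free_sides Y" for x y
  proof -
    have y: "y = across Y x" "x \<in> corners R" using that by (simp_all only: free_sides_iff corners)
    show ?thesis
    proof (cases "x = p \<or> x = q")
      case True then show ?thesis using y across_Y by auto
    next
      case False
      then have "y \<noteq> p" "y \<noteq> q" using y across_Y across_across by metis+
      then show ?thesis
        using False y fg_across(2)[of x] map_corners by (simp only: free_sides_iff corners) blast
    qed
  qed
  have "card (corners R // ?E\<^sup>*) = card (corners R // ?F\<^sup>*)"
  proof (rule card_quotient_eqI[where f = ?f and g = ?g])
    show "sym ?E" "sym ?F"
      using arcs_X arcs_Y by (metis sym_Un sym_vertex_arcs sym_free_sides)+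
    show "(?f x, ?f y) \<in> ?F\<^sup>*" if "(x, y) \<in> ?E" for x y
      using slide_map_arcs[OF sym_vertex_arcs N pq_Y fX ne(1-3) that] by simp
    show "(?g x, ?g y) \<in> ?E\<^sup>*" if "(x, y) \<in> ?F" for x y
      using slide_map_arcs[OF sym_vertex_arcs N pq_X(2,1) gY not_sym[OF ne(1)] ne(3,2) that] by simp
    have A_E: "((A, opp (snd p)), p) \<in> ?E" and A_F: "((A, opp (snd q)), q) \<in> ?F"
      by (auto simp: insert_arcs_def)
    then have "((A, opp (snd p)), q) \<in> ?E\<^sup>*" "((A, opp (snd q)), p) \<in> ?F\<^sup>*"
      using pq_X pq_Y by (meson UnI2 r_into_rtrancl rtrancl.rtrancl_into_rtrancl)+
    with A_E A_F show "(?g (?f x), x) \<in> ?E\<^sup>*" "(?f (?g x), x) \<in> ?F\<^sup>*" for x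
      using ne by (auto simp: slide_map_slide_map)
  qed (use map_corners in auto)
  \<comment> \<open>Whether a disc is empty is decided by its word without \<open>A\<close>, since
    insertion neither fills an empty word nor empties another.\<close>
  moreover have "{v \<in> verts Y. rot Y v = []} = {v \<in> verts X. rot X v = []}"
    by (simp add: fields) (simp add: XY move_end_def)
  ultimately show ?thesis
    unfolding boundary_components_def boundary_arcs_sym p_def[symmetric] XY[symmetric] arcs_X arcs_Y corners by simp
qed

subsection \<open>States\<close>

text \<open>The boundary depends on the words only up to rotation, and on the flags only of ribbons
  that are present.\<close>

lemma boundary_components_cong:
  assumes "verts R' = verts R" "ribbons R' = ribbons R"
    and "\<And>e. e \<in> ribbons R \<Longrightarrow> twist R' e = twist R e"
    and "\<And>v. v \<in> verts R \<Longrightarrow> cyc_pairs (rot R' v) = cyc_pairs (rot R v)"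
  shows "boundary_components R' = boundary_components R"
proof -
  have "cyc_pairs w = {} \<longleftrightarrow> w = []" for w :: "'b ribbon_end list"
    by (cases w) (auto simp: cyc_pairs_def neq_Nil_conv)
  then have "{v \<in> verts R'. rot R' v = []} = {v \<in> verts R. rot R v = []}"
    using assms(1,4) by (metis (mono_tags, lifting))
  moreover have "follows R' = follows R"
    using assms(1,4) by (auto simp: fun_eq_iff follows_cyc_pairs)
  moreover have "corners R' = corners R"
    using assms(2) by (simp add: corners_def ends_def)
  moreover have "free_sides R' = free_sides R"
  proof -
    have "across R' p = across R p" if "p \<in> corners R" for p
      using that assms(3) by (cases "(R, p)" rule: across.cases) (auto simp: corners_def ends_def)
    then show ?thesis
      unfolding free_sides_def \<open>corners R' = corners R\<close> by (intro Collect_cong) metis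
  qed
  ultimately show ?thesis
    unfolding boundary_components_def boundary_arcs_sym vertex_arcs_def by simp
qed

lemma half_twist_half_twist [simp]: "half_twist F (half_twist F R) = R"
  by (simp add: half_twist_def cong: if_cong)

lemma ribbons_simps [simp]:
  "ribbons (move_end A p R) = ribbons R"
  "ribbons (half_twist F R) = ribbons R"
  "ribbons (slide A p R) = ribbons R"
  by (simp_all add: move_end_def half_twist_def slide_def Let_def)

lemma slide_eq:
  "slide A (B, s) R =
    (if twist R (fst B) then half_twist {fst A} else id) (move_end A (across R (B, s)) R)"
  by (cases B) (simp add: slide_def)

lemma move_end_move_end:
  assumes "A \<noteq> B"
  shows "move_end A q (move_end A (B, s) R) = move_end A q R"
  using assms by (simp add: move_end_def filter_insert_at_absent)

lemma is_ribbon_graph_state: "is_ribbon_graph R \<Longrightarrow> is_ribbon_graph (state R L)"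
  unfolding is_ribbon_graph_def by (auto simp: state_def erase_def half_twist_def ends_def)

lemma twist_state: "e \<in> ribbons R \<Longrightarrow> twist (state R L) e = (twist R e \<noteq> (L e = Psi))"
  by (auto simp: state_def erase_def half_twist_def)

lemma ribbons_state: "e \<in> ribbons (state R L) \<longleftrightarrow> e \<in> ribbons R \<and> L e \<noteq> Phi"
  by (auto simp: state_def erase_def half_twist_def)

lemma state_move_end:
  assumes "L (fst A) \<noteq> Phi" "L (fst B) \<noteq> Phi"
  shows "state (move_end A (B, s) R) L = move_end A (B, s) (state R L)"
  using assms
  by (simp add: state_def erase_def half_twist_def move_end_def filter_insert_at conj_commute)

lemma state_half_twist: "state (half_twist F R) L = half_twist F (state R L)"
  by (auto simp: state_def erase_def half_twist_def fun_eq_iff)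

text \<open>The effect on a label of one more half-twist of its ribbon.\<close>

fun flip :: "label \<Rightarrow> label" where
  "flip Phi = Phi"
| "flip Chi = Psi"
| "flip Psi = Chi"

lemma flip_flip [simp]: "flip (flip l) = l"
  by (cases l) auto

lemma flip_eq_Phi [simp]: "flip l = Phi \<longleftrightarrow> l = Phi"
  by (cases l) auto

lemma state_flip:
  assumes "a \<in> ribbons R" "L a \<noteq> Phi"
  shows "state R (L(a := flip (L a))) = half_twist {a} (state R L)"
proof -
  have "{e \<in> ribbons R. (L(a := flip (L a))) e = Phi} = {e \<in> ribbons R. L e = Phi}"
    using assms by auto
  moreover have "half_twist {e \<in> ribbons R. (L(a := flip (L a))) e = Psi} R =
      half_twist {a} (half_twist {e \<in> ribbons R. L e = Psi} R)"
    using assms by (cases "L a") (auto simp: half_twist_def fun_eq_iff)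
  ultimately show ?thesis
    by (simp add: state_def erase_def half_twist_def)
qed

text \<open>The label \<open>Chi\<close> leaves the flag of the ribbon of \<open>B\<close>
  unchanged, so the free side has the same target in the graph and in its state.\<close>

lemma state_slide_Chi:
  assumes "L (fst A) \<noteq> Phi" "fst B \<in> ribbons R" "L (fst B) = Chi"
  shows "state (slide A (B, s) R) L = slide A (B, s) (state R L)"
  using assms by (cases B) (simp add: slide_eq state_half_twist state_move_end twist_state)

text \<open>A half-twist of the ribbon makes its free side from \<open>(B, s)\<close> end where the other free side ended.\<close>

lemma state_slide_Psi:
  assumes "fst A \<in> ribbons R" "L (fst A) \<noteq> Phi" "fst B \<in> ribbons R" "L (fst B) = Psi"
  shows "state (slide A (B, opp s) R) (L(fst A := flip (L (fst A)))) = slide A (B, s) (state R L)"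
  using assms
  by (cases B) (simp add: state_flip slide_eq state_half_twist state_move_end twist_state)

lemma state_move_end_erased:
  assumes "fst A \<in> ribbons R" "L (fst A) = Phi"
  shows "state (move_end A p R) L = state R L"
proof -
  have "filter (\<lambda>d. fst d \<notin> {e \<in> ribbons R. L e = Phi}) (insert_at A p (filter (\<lambda>d. d \<noteq> A) w)) =
      filter (\<lambda>d. fst d \<notin> {e \<in> ribbons R. L e = Phi}) w" for w
    using assms by (cases p) (auto simp: filter_insert_at_absent intro!: filter_cong)
  then show ?thesis
    by (simp add: state_def erase_def half_twist_def move_end_def)
qed

text \<open>The states themselves may differ in the flag of the erased ribbon, which the boundary
  does not see.\<close>

lemma boundary_components_slide_erased:
  assumes "fst A \<in> ribbons R" "L (fst A) = Phi"
  shows "boundary_components (state (slide A (B, s) R) L) = boundary_components (state R L)"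
proof -
  have "boundary_components (half_twist {fst A} (state R L)) = boundary_components (state R L)"
    using assms by (intro boundary_components_cong) (auto simp: ribbons_state half_twist_def)
  then show ?thesis
    using assms by (simp add: slide_eq state_half_twist state_move_end_erased)
qed

lemma state_move_end_side:
  assumes "fst B \<in> ribbons R" "L (fst B) = Phi"
  shows "state (move_end A (B, s) R) L = state (move_end A (B, s') R) L"
proof -
  have "filter (\<lambda>d. fst d \<notin> {e \<in> ribbons R. L e = Phi}) (insert_at A (B, s) w) =
      filter (\<lambda>d. fst d \<notin> {e \<in> ribbons R. L e = Phi}) (insert_at A (B, s') w)" for w
    using assms by (intro filter_insert_at_side) auto
  then show ?thesis
    by (simp add: state_def erase_def half_twist_def move_end_def)
qed

text \<open>Both slides arrive at the other end of the same erased ribbon, and both toggle the flag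
  of the ribbon of \<open>A\<close> or neither does.\<close>

lemma state_slide_side:
  assumes "fst B \<in> ribbons R" "L (fst B) = Phi"
  shows "state (slide A (B, s) R) L = state (slide A (B, s') R) L"
proof -
  have "state (move_end A ((fst B, \<not> snd B), r) R) L = state (move_end A ((fst B, \<not> snd B), r') R) L"
    for r r'
    using assms by (intro state_move_end_side) auto
  \<comment> \<open>The first instance serves a twisted ribbon, where the slide keeps the side, and
    the second an untwisted one.\<close>
  from this[of s s'] this[of "opp s" "opp s'"] show ?thesis
    by (cases B) (simp add: slide_eq state_half_twist)
qed

text \<open>Reinserting \<open>A\<close> where it already is can only change the starting point of
  the word. This puts \<open>R\<close> itself into the form
  \<open>move_end A (B, s) R\<close>.\<close>

lemma neighboring_rotation:
  assumes R: "is_ribbon_graph R" and AB: "fst A \<in> ribbons R" "fst B \<in> ribbons R" "A \<noteq> B"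
    and nb: "neighboring R A (B, s)" and u: "u \<in> verts R"
  shows "\<exists>x y. rot R u = x @ y \<and> rot (move_end A (B, s) R) u = y @ x"
proof -
  let ?ins = "\<lambda>w. insert_at A (B, s) (filter (\<lambda>d. d \<noteq> A) w)"
  obtain v where v: "v \<in> verts R" "A \<in> set (rot R v)" "B \<in> set (rot R v)"
    and pair: "(if s = Before then (A, B) else (B, A)) \<in> cyc_pairs (rot R v)"
    using nb by (cases s) (auto simp: follows_cyc_pairs dest: cyc_pairs_subset)
  have dist: "distinct (rot R v)"
    using R v(1) by (simp add: is_ribbon_graph_def)
  \<comment> \<open>Cyclic neighbors are adjacent in the list or wrap around from its last to its
    first entry; only the second case gives a nontrivial rotation.\<close>
  have cyc: "(\<exists>x y. w = x @ c # d # y) \<or> (\<exists>m. w = d # m @ [c])"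
    if "(c, d) \<in> cyc_pairs w" "c \<noteq> d" for c d :: "'b ribbon_end" and w
  proof -
    obtain i where i: "i < length w" "w ! i = c" "rotate1 w ! i = d"
      using \<open>(c, d) \<in> cyc_pairs w\<close> by (auto simp: cyc_pairs_def set_zip)
    show ?thesis
    proof (cases "Suc i < length w")
      case True
      then have "w = take i w @ c # d # drop (Suc (Suc i)) w"
        using i by (metis Cons_nth_drop_Suc Suc_lessD append_take_drop_id mod_less nth_rotate1)
      then show ?thesis by blast
    next
      case False
      then have i_eq: "Suc i = length w" using i(1) by simp
      have "w \<noteq> []"
        using i(1) by auto
      moreover from this have "last w = c"
        using i(2) i_eq by (metis diff_Suc_1 last_conv_nth)
      moreover from \<open>w \<noteq> []\<close> have "hd w = d"
        using i i_eq by (metis hd_conv_nth mod_self nth_rotate1)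
      ultimately show ?thesis
        using \<open>c \<noteq> d\<close> by (metis append_butlast_last_id append_is_Nil_conv hd_append2 last_ConsL list.collapse append_self_conv2 list.sel(1) append_Cons)
    qed
  qed
  show ?thesis
  proof (cases "u = v")
    case True
    have fil: "filter (\<lambda>d. d \<noteq> A) w = w" if "A \<notin> set w" for w
      using that by (simp add: filter_id_conv) blast
    show ?thesis
    proof (cases s)
      case Before
      with pair cyc[of A B "rot R v"] AB(3)
      consider x y where "rot R v = x @ A # B # y" | m where "rot R v = B # m @ [A]"
        by auto
      then show ?thesis
      proof cases
        case 1
        then have "?ins (rot R v) = rot R v"
          using dist Before AB(3) by (simp add: fil insert_at_append insert_at_notin)
        then show ?thesis
          by (simp add: True move_end_def exI[of _ "[]"])
      next
        case 2
        then have "?ins (rot R v) = [A] @ B # m"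
          using dist Before AB(3) by (simp add: fil insert_at_append insert_at_notin)
        moreover have "rot R v = (B # m) @ [A]"
          using 2 by simp
        ultimately show ?thesis
          unfolding True move_end_def by (metis select_convs(3) surjective update_convs(3))
      qed
    next
      case After
      with pair cyc[of B A "rot R v"] AB(3)
      consider x y where "rot R v = x @ B # A # y" | m where "rot R v = A # m @ [B]"
        by auto
      then show ?thesis
      proof cases
        case 1
        then have "?ins (rot R v) = rot R v"
          using dist After AB(3) by (simp add: fil insert_at_append insert_at_notin)
        then show ?thesis
          by (simp add: True move_end_def exI[of _ "[]"])
      next
        case 2
        then have "?ins (rot R v) = (m @ [B]) @ [A]"
          using dist After AB(3) by (simp add: fil insert_at_append insert_at_notin)
        moreover have "rot R v = [A] @ (m @ [B])"
          using 2 by simp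
        ultimately show ?thesis
          unfolding True move_end_def by (metis select_convs(3) surjective update_convs(3))
      qed
    qed
  next
    case False
    have "A \<in> ends R" "B \<in> ends R"
      using AB by (cases A; cases B; auto simp: ends_def)+
    then have "A \<notin> set (rot R u)" "B \<notin> set (rot R u)"
      using R u v False unfolding is_ribbon_graph_def by metis+
    then have "?ins (rot R u) = rot R u"
      by (metis (mono_tags, lifting) filter_True insert_at_notin)
    then show ?thesis
      by (simp add: move_end_def exI[of _ "[]"])
  qed
qed

text \<open>Erasing filters both pieces of a rotated word separately, so the rotation passes to the
  states.\<close>

lemma boundary_components_state_neighboring:
  assumes "is_ribbon_graph R" "fst A \<in> ribbons R" "fst B \<in> ribbons R" "A \<noteq> B"
    and "neighboring R A (B, s)"
  shows "boundary_components (state (move_end A (B, s) R) L) = boundary_components (state R L)"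
proof (rule boundary_components_cong)
  fix v
  assume "v \<in> verts (state R L)"
  then have "v \<in> verts R"
    by (simp add: state_def erase_def half_twist_def)
  then obtain x y where "rot R v = x @ y" "rot (move_end A (B, s) R) v = y @ x"
    using neighboring_rotation[OF assms] by blast
  then show "cyc_pairs (rot (state (move_end A (B, s) R) L) v) = cyc_pairs (rot (state R L) v)"
    by (simp add: state_def erase_def half_twist_def cyc_pairs_append_commute)
qed (auto simp: state_def erase_def half_twist_def move_end_def)

subsection \<open>The four-term relation\<close>

definition weight :: "'e set \<Rightarrow> ('e \<Rightarrow> label) \<Rightarrow> poly_stx" where
  "weight F L = var_s ^ card {e \<in> F. L e = Phi} * var_t ^ card {e \<in> F. L e = Chi} *
     (- var_t) ^ card {e \<in> F. L e = Psi}"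

text \<open>The product form lets the factor of a single ribbon be split off.\<close>

lemma weight_eq_prod:
  assumes "finite F"
  shows "weight F L =
    (\<Prod>e\<in>F. case L e of Phi \<Rightarrow> var_s | Chi \<Rightarrow> var_t | Psi \<Rightarrow> - var_t)"
proof -
  have "(\<Prod>e\<in>F. case L e of Phi \<Rightarrow> var_s | Chi \<Rightarrow> var_t | Psi \<Rightarrow> - var_t) =
      (\<Prod>e\<in>F. (if L e = Phi then var_s else 1) * (if L e = Chi then var_t else 1) *
        (if L e = Psi then - var_t else 1))"
  proof (rule prod.cong)
    show "(case L e of Phi \<Rightarrow> var_s | Chi \<Rightarrow> var_t | Psi \<Rightarrow> - var_t) =
        (if L e = Phi then var_s else 1) * (if L e = Chi then var_t else 1) *
        (if L e = Psi then - var_t else 1)" for e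
      by (cases "L e") auto
  qed simp
  also have "\<dots> = weight F L"
    using assms by (simp add: prod.distrib weight_def flip: prod.inter_filter)
  finally show ?thesis ..
qed

lemma weight_flip:
  assumes "finite F" "a \<in> F" "L a \<noteq> Phi"
  shows "weight F (L(a := flip (L a))) = - weight F L"
proof -
  have "(\<Prod>e\<in>F - {a}. case (L(a := flip (L a))) e of Phi \<Rightarrow> var_s | Chi \<Rightarrow> var_t | Psi \<Rightarrow> - var_t) =
      (\<Prod>e\<in>F - {a}. case L e of Phi \<Rightarrow> var_s | Chi \<Rightarrow> var_t | Psi \<Rightarrow> - var_t)"
    by (intro prod.cong) auto
  then show ?thesis
    using assms(3) unfolding weight_eq_prod[OF assms(1)] prod.remove[OF assms(1,2)]
    by (cases "L a") auto
qed

theorem mainTheorem3: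
  fixes R :: "('v, 'e) ribbon_graph"
    and a b :: 'e and A B\<^sub>1 :: "'e ribbon_end" and s :: side
  assumes "is_ribbon_graph R"
    and "a \<in> ribbons R" and "b \<in> ribbons R" and "a \<noteq> b"
    and "fst A = a" and "fst B\<^sub>1 = b"
    and "neighboring R A (B\<^sub>1, s)"
  shows "Q R - Q (exchange A (B\<^sub>1, s) R) - Q (slide A (B\<^sub>1, s) R)
           + Q (slide A (B\<^sub>1, opp s) (exchange A (B\<^sub>1, s) R)) = 0"
proof -
  note R = assms(1)
  have A: "fst A \<in> ribbons R" and B: "fst B\<^sub>1 \<in> ribbons R" and AB: "fst A \<noteq> fst B\<^sub>1" "A \<noteq> B\<^sub>1"
    using assms by auto
  let ?M = "\<lambda>s. move_end A (B\<^sub>1, s) R" and ?S = "\<lambda>s. slide A (B\<^sub>1, s) R"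
  let ?c = "\<lambda>G L. boundary_components (state G L)"
  have exch: "exchange A (B\<^sub>1, s) R = ?M (opp s)"
    by simp
  have "across (?M (opp s)) (B\<^sub>1, opp s) = across R (B\<^sub>1, opp s)"
    by (cases B\<^sub>1) (simp add: move_end_def)
  moreover have "twist (?M (opp s)) = twist R"
    by (simp add: move_end_def)
  \<comment> \<open>\<open>move_end\<close> forgets the current place of \<open>A\<close>, so
    sliding after the exchange equals sliding from \<open>opp s\<close> directly.\<close>
  ultimately have slide2: "slide A (B\<^sub>1, opp s) (?M (opp s)) = ?S (opp s)"
    using AB(2) by (simp add: slide_eq move_end_move_end)
  have c1: "?c R L = ?c (?M s) L" for L
    using boundary_components_state_neighboring[OF R A B AB(2) assms(7)] by simp
  have slide_state: "boundary_components (slide A (B\<^sub>1, r) (state R L)) = ?c (?M r) L"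
    if "L (fst A) \<noteq> Phi" "L (fst B\<^sub>1) \<noteq> Phi" for L r
    using that A B AB(1) boundary_components_slide[OF is_ribbon_graph_state[OF R], of A L B\<^sub>1 r]
    by (simp add: ribbons_state state_move_end)
  \<comment> \<open>An involution of the labellings by which the sums of both slid graphs are
    reindexed; it fixes a labelling with \<open>Phi\<close> on \<open>a\<close>, because
    \<open>flip\<close> does.\<close>
  define \<phi> where "\<phi> L = (if L b = Psi then L(a := flip (L a)) else L)" for L
  define T where "T G L = weight (ribbons R) L * var_x ^ (?c G L - 1)" for G :: "('v, 'e) ribbon_graph" and L
  let ?I = "ribbons R \<rightarrow>\<^sub>E (UNIV :: label set)"
  have Q: "Q G = sum (T G) ?I" if "ribbons G = ribbons R" for G :: "('v, 'e) ribbon_graph"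
    using that by (simp add: Q_def T_def weight_def)
  have \<phi>_I: "\<phi> L \<in> ?I" if "L \<in> ?I" for L
    using that assms(2) by (auto simp: \<phi>_def PiE_iff extensional_def)
  have \<phi>\<phi>: "\<phi> (\<phi> L) = L" for L
    using assms(4) by (simp add: \<phi>_def)
  have reindex: "sum (T G) ?I = (\<Sum>L\<in>?I. T G (\<phi> L))" for G
    by (rule sum.reindex_bij_witness[where i = \<phi> and j = \<phi>]) (simp_all add: \<phi>\<phi> \<phi>_I)
  \<comment> \<open>After the reindexing, the relation holds for each labelling separately.\<close>
  have "T R L - T (?M (opp s)) L - T (?S s) (\<phi> L) + T (?S (opp s)) (\<phi> L) = 0" for L
  proof (cases "L a = Phi")
    case True
    then have "\<phi> L = L"
      by (auto simp: \<phi>_def fun_eq_iff)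
    then show ?thesis
      using True A assms(5)
      by (simp add: T_def state_move_end_erased boundary_components_slide_erased)
  next
    case a: False
    show ?thesis
    proof (cases "L b")
      case Phi
      then have "T R L = T (?M (opp s)) L" "T (?S s) L = T (?S (opp s)) L"
        using B assms(6) c1 state_move_end_side[of B\<^sub>1 R L A s "opp s"]
          state_slide_side[of B\<^sub>1 R L A s "opp s"]
        by (simp_all add: T_def)
      then show ?thesis
        using Phi by (simp add: \<phi>_def)
    next
      case Chi
      then have "T (?S r) L = T (?M r) L" for r
        using a B assms(5,6) state_slide_Chi[of L A B\<^sub>1 R r] slide_state[of L r]
        by (simp add: T_def)
      moreover have "T R L = T (?M s) L"
        by (simp add: T_def c1)
      ultimately show ?thesis
        using Chi by (simp add: \<phi>_def)
    next
      case Psi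
      have w: "weight (ribbons R) (\<phi> L) = - weight (ribbons R) L"
        using weight_flip[of "ribbons R" a L] R a assms(2) Psi
        by (simp add: \<phi>_def is_ribbon_graph_def)
      \<comment> \<open>The slide from \<open>opp r\<close>, evaluated at \<open>\<phi> L\<close>,
        is in the state a slide from \<open>r\<close>, which can be undone.\<close>
      have "?c (?S (opp r)) (\<phi> L) = ?c (?M r) L" for r
        using a A B Psi assms(5,6) state_slide_Psi[of A R L B\<^sub>1 r] slide_state[of L r]
        by (simp add: \<phi>_def)
      from this[of s] this[of "opp s"]
      have "T (?S (opp s)) (\<phi> L) = - T (?M s) L" "T (?S s) (\<phi> L) = - T (?M (opp s)) L"
        by (simp_all add: T_def w)
      moreover have "T R L = T (?M s) L"
        by (simp add: T_def c1)
      ultimately show ?thesis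
        by simp
    qed
  qed
  then have "(\<Sum>L\<in>?I. T R L - T (?M (opp s)) L - T (?S s) (\<phi> L) + T (?S (opp s)) (\<phi> L)) = 0"
    by simp
  then show ?thesis
    unfolding exch slide2
    by (simp add: Q reindex[of "?S _"] sum.distrib sum_subtractf)
qed

end
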